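(* Let $g\in\mathcal{G}_1$ and assume that $g\neq g_\theta$ (as elements of $\mathcal{G}_1$) for all $0<\theta<\pi$. Then the value $$I_g = -\frac{1}{\pi}\int_{\mathbb{C}}\frac{g(u)}{\overline{(u+1)}\,(u-1)}\,da(u)$$ is in the open convex region $\Omega_1$ bounded by the curve $\Gamma_0$ parametrized by $$z(\theta)=\ln(2\sin\theta)+i\left(\frac{\pi}{2}-\theta\right),\qquad 0<\theta<\pi.$$
   Context: $\mathcal{G}_1$ denotes the set of (almost-everywhere) equivalence classes of compactly supported (i.e. with compact essential support) bounded measurable functions $g$ on the complex plane $\mathbb{C}$ satisfying $0\le g\le 1$. Here $a$ denotes area (Lebesgue) measure on $\mathbb{C}$. For $0<\theta<\pi$, $D_\theta$ is the disc with center $i\cot\theta$ and radius $\csc\theta$, and $g_\theta=\chi_{D_\theta}$ is its characteristic function. The region $\Omega_1$ is the image of the open disc $\{z\in\mathbb{C}: |z-1|<1\}$ under the principal branch of the logarithm ($-\pi<\operatorname{Arg} z\le\pi$); the curve $\Gamma_0$ is the image under the same map of the circle $|z-1|=1$ with the origin removed. *)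

theory Defs
  imports "HOL-Analysis.Analysis"
begin

definition ess_support :: "(complex \<Rightarrow> real) \<Rightarrow> complex set" where
  "ess_support g = - \<Union> {U. open U \<and> (AE u in lebesgue. u \<in> U \<longrightarrow> g u = 0)}"

(* The elements of the space are a.e. equivalence classes; they are handled through arbitrary
   representatives, so every condition below depends only on the class of g, and equality of
   elements is ae_eq. *)
definition G1 :: "(complex \<Rightarrow> real) set" where
  "G1 = {g. g \<in> borel_measurable lebesgue
          \<and> compact (ess_support g)
          \<and> (AE u in lebesgue. 0 \<le> g u \<and> g u \<le> 1)}"

definition ae_eq :: "(complex \<Rightarrow> real) \<Rightarrow> (complex \<Rightarrow> real) \<Rightarrow> bool" where
  "ae_eq g h \<longleftrightarrow> (AE u in lebesgue. g u = h u)"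

(* The radius is csc \<theta>. Taking the disc open rather than closed does not affect the
   a.e. class of its characteristic function. *)
definition disc_D :: "real \<Rightarrow> complex set" where
  "disc_D \<theta> = ball (\<i> * complex_of_real (cot \<theta>)) (1 / sin \<theta>)"

definition g_disc :: "real \<Rightarrow> complex \<Rightarrow> real" where
  "g_disc \<theta> = indicator (disc_D \<theta>)"

definition I_integrand :: "(complex \<Rightarrow> real) \<Rightarrow> complex \<Rightarrow> complex" where
  "I_integrand g u = complex_of_real (g u) / (cnj (u + 1) * (u - 1))"

definition I_val :: "(complex \<Rightarrow> real) \<Rightarrow> complex" where
  "I_val g = - (1 / complex_of_real pi) * (LINT u|lebesgue. I_integrand g u)"

definition Omega1 :: "complex set" where
  "Omega1 = Ln ` {z. cmod (z - 1) < 1}"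

definition Gamma0 :: "complex set" where
  "Gamma0 = Ln ` ({z. cmod (z - 1) = 1} - {0})"

end

theory Submission imports Defs begin

text \<open>
  Fix \<open>\<theta>\<close> in \<open>(0, pi)\<close> and look at the real linear functional \<open>Im (cis \<theta> * I_val g)\<close>. It is \<open>- 1 / pi\<close>
  times the integral of \<open>g\<close> against the weight \<open>Im (cis \<theta> / (cnj (u + 1) * (u - 1)))\<close>, and this weight is
  negative inside \<open>disc_D \<theta>\<close> and positive outside its closure (lemma \<open>Im_cis_kernel\<close>). Since \<open>0 \<le> g \<le> 1\<close>, the
  functional is maximised by the characteristic function of that disc and by no other class (lemma
  \<open>Im_cis_I_val_less\<close>). So \<open>I_val g\<close> lies strictly on one side of a line through \<open>I_val (g_disc \<theta>)\<close>, for
  each \<open>\<theta>\<close>, as soon as \<open>g\<close> is none of the extremal discs.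

  The values at the extremal discs are \<open>ln (2 * sin \<theta>) + \<i> * (pi / 2 - \<theta>)\<close> (lemma \<open>I_val_disc\<close>). After
  translating the centre of the disc to the origin, the integrand is, up to a radial factor, one plus a
  power series in \<open>v\<close> and one in \<open>cnj v\<close> without constant terms. Those powers integrate to zero over
  concentric discs by rotational symmetry, and the remaining radial integral is a logarithm (lemma
  \<open>integral_cball_kernel\<close>).

  Finally \<open>Omega1\<close> is exactly the intersection of these open half-planes (lemma
  \<open>Omega1_iff_half_planes\<close>), which gives both the membership of \<open>I_val g\<close> and convexity. That the lines
  support the curve is itself an instance of the extremal property, applied to the discs. Openness and
  the frontier follow from the description of \<open>Omega1\<close> in the strip \<open>\<bar>Im z\<bar> < pi / 2\<close> by
  \<open>exp (Re z) < 2 * cos (Im z)\<close>.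
\<close>

section \<open>Rotational and radial symmetry of area measure\<close>

text \<open>
  Area on the complex plane is transported from \<open>real^2\<close>, where orthogonal maps are known to preserve
  it. The preimage of a box under the identification is a box of the same area, an orthogonal map before
  it keeps that area, and the areas of boxes determine Lebesgue measure.
\<close>
lemma lborel_complex_eq_distr_orthogonal:
  fixes \<rho> :: "real^2 \<Rightarrow> real^2"
  assumes "orthogonal_transformation \<rho>"
  shows "lborel = distr lborel borel (\<lambda>x. Complex (\<rho> x $ 1) (\<rho> x $ 2))"
proof (rule lborel_eqI)
  have lin: "linear \<rho>" using assms by (simp add: orthogonal_transformation_linear)
  then have cont: "continuous_on UNIV \<rho>" by (rule linear_continuous_on_compose[OF continuous_on_id, unfolded id_def])
  have meas [measurable]: "\<rho> \<in> borel_measurable borel"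
    using cont by (rule borel_measurable_continuous_onI)
  have [measurable]: "(\<lambda>x. Complex (\<rho> x $ 1) (\<rho> x $ 2)) \<in> borel_measurable borel"
    unfolding Complex_eq by (intro borel_measurable_continuous_onI continuous_intros cont)
  fix l u :: complex
  assume le: "\<And>b. b \<in> Basis \<Longrightarrow> l \<bullet> b \<le> u \<bullet> b"
  then have le': "Re l \<le> Re u" "Im l \<le> Im u"
    using le[of 1] le[of \<i>] by (auto simp: Basis_complex_def)
  define B where "B = box (vector [Re l, Im l]) (vector [Re u, Im u] :: real^2)"
  have pre: "(\<lambda>x. Complex (\<rho> x $ 1) (\<rho> x $ 2)) -` box l u = \<rho> -` B"
    by (auto simp: B_def mem_box_cart in_box_complex_iff forall_2)
  have B: "B \<in> lmeasurable" "B \<in> sets borel" by (auto simp: B_def)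
  obtain \<rho>' where inv: "orthogonal_transformation \<rho>'" "\<And>x. \<rho>' (\<rho> x) = x" "\<And>x. \<rho> (\<rho>' x) = x"
    using assms orthogonal_transformation_inv orthogonal_transformation_bij
    by (metis bij_inv_eq_iff)
  have img: "\<rho> -` B = \<rho>' ` B"
    using inv by (auto simp: image_iff) metis
  have "emeasure (distr lborel borel (\<lambda>x. Complex (\<rho> x $ 1) (\<rho> x $ 2))) (box l u) = emeasure lborel (\<rho> -` B)"
    by (subst emeasure_distr) (simp_all add: pre)
  also have "\<dots> = emeasure lebesgue (\<rho>' ` B)"
    using measurable_sets[OF meas B(2)] by (simp add: img)
  also have "\<dots> = emeasure lebesgue B"
    using measure_orthogonal_image[OF inv(1) B(1)] measurable_orthogonal_image[OF inv(1) B(1)] B(1)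
    by (simp add: emeasure_eq_measure2)
  also have "\<dots> = (\<Prod>b\<in>Basis. (u - l) \<bullet> b)"
  proof -
    have B2: "(Basis :: (real^2) set) = {axis 1 1, axis 2 1}"
      by (auto simp: Basis_vec_def UNIV_2)
    have "axis 1 1 \<noteq> (axis 2 1 :: real^2)"
      by (simp add: axis_eq_axis)
    then show ?thesis
      using le' by (simp add: B_def B2 Basis_complex_def emeasure_lborel_box_eq inner_axis)
  qed
  finally show "emeasure (distr lborel borel (\<lambda>x. Complex (\<rho> x $ 1) (\<rho> x $ 2))) (box l u) =  (\<Prod>b\<in>Basis. (u - l) \<bullet> b)" .
qed simp

lemma distr_lborel_rotation:
  assumes "cmod w = 1"
  shows "distr lborel borel (\<lambda>v. w * v) = lborel"
proof -
  define \<phi> :: "real^2 \<Rightarrow> complex" where "\<phi> = (\<lambda>x. Complex (x $ 1) (x $ 2))"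
  define \<rho> :: "real^2 \<Rightarrow> real^2" where "\<rho> = (\<lambda>x. vector [Re (w * \<phi> x), Im (w * \<phi> x)])"
  have [measurable]: "\<phi> \<in> borel_measurable borel"
    unfolding \<phi>_def Complex_eq by (intro borel_measurable_continuous_onI continuous_intros)
  have norm_eq: "norm x = cmod (\<phi> x)" for x
    by (simp add: \<phi>_def norm_vec_def L2_set_def sum_2 cmod_def)
  have \<phi>\<rho>: "\<phi> (\<rho> x) = w * \<phi> x" for x
    by (simp add: \<phi>_def \<rho>_def complex_eq_iff)
  have "linear \<rho>"
    by (rule linearI) (simp_all add: vec_eq_iff forall_2 \<rho>_def \<phi>_def algebra_simps)
  then have orth: "orthogonal_transformation \<rho>"
    using assms by (simp add: orthogonal_transformation norm_eq \<phi>\<rho> norm_mult)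
  have base: "lborel = distr lborel borel \<phi>"
    using lborel_complex_eq_distr_orthogonal[OF orthogonal_transformation_id]
    by (simp add: \<phi>_def)
  have "distr lborel borel (\<lambda>v. w * v) = distr (distr lborel borel \<phi>) borel (\<lambda>v. w * v)"
    by (simp flip: base)
  also have "\<dots> = distr lborel borel (\<lambda>x. \<phi> (\<rho> x))"
    by (subst distr_distr) (simp_all add: \<phi>\<rho> o_def)
  also have "\<dots> = lborel"
    using lborel_complex_eq_distr_orthogonal[OF orth] by (simp add: \<phi>_def)
  finally show ?thesis .
qed

text \<open>
  The substitution \<open>t = r\<^sup>2\<close>, \<open>dt = 2 r dr\<close> in polar coordinates, without polar coordinates: the set
  \<open>\<bar>v\<bar>\<^sup>2 < t\<close> is a disc of area \<open>pi * t\<close>, so the squared modulus pushes area measure forward to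
  \<open>pi\<close> times length on the half-line.
\<close>
lemma distr_lborel_cmod_square:
  "distr lborel borel (\<lambda>v. (cmod v)\<^sup>2) = density lborel (\<lambda>t. ennreal (pi * indicator {0..} t))"
proof -
  let ?D = "density lborel (\<lambda>t. ennreal (pi * indicator {0..} t))"
  \<comment> \<open>The reflection makes the upper rays, which determine a measure on the line, have finite measure.\<close>
  have "distr lborel borel (\<lambda>v. - (cmod v)\<^sup>2) = distr ?D borel uminus"
  proof (rule measure_eqI_lessThan)
    fix x :: real
    define s where "s = max 0 (- x)"
    have "x < - (cmod v)\<^sup>2 \<longleftrightarrow> cmod v < sqrt s" for v
    proof -
      have "x < - (cmod v)\<^sup>2 \<longleftrightarrow> (cmod v)\<^sup>2 < s"
        unfolding s_def using zero_le_power2[of "cmod v"] by linarith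
      also have "\<dots> \<longleftrightarrow> sqrt ((cmod v)\<^sup>2) < sqrt s"
        by (rule real_sqrt_less_iff[symmetric])
      finally show ?thesis by simp
    qed
    then have pre: "(\<lambda>v. - (cmod v)\<^sup>2) -` {x<..} = ball 0 (sqrt s)"
      unfolding vimage_def greaterThan_iff ball_def dist_0_norm by simp
    have "emeasure (distr lborel borel (\<lambda>v. - (cmod v)\<^sup>2)) {x<..} = emeasure lborel (ball (0::complex) (sqrt s))"
      by (subst emeasure_distr) (simp_all add: pre)
    also have "\<dots> = ennreal (pi * s)"
      by (simp add: emeasure_ball unit_ball_vol_2 s_def)
    finally have 1: "emeasure (distr lborel borel (\<lambda>v. - (cmod v)\<^sup>2)) {x<..} = ennreal (pi * s)" .
    have "emeasure (distr ?D borel uminus) {x<..} = emeasure ?D {..<- x}"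
      by (subst emeasure_distr) (auto intro!: arg_cong[where f = "emeasure _"])
    also have "\<dots> = (\<integral>\<^sup>+t. ennreal (pi * indicator {0..} t) * indicator {..<- x} t \<partial>lborel)"
      by (rule emeasure_density) auto
    also have "\<dots> = (\<integral>\<^sup>+t. ennreal pi * indicator {0..<s} t \<partial>lborel)"
      by (rule nn_integral_cong) (auto simp: indicator_def s_def)
    also have "\<dots> = ennreal (pi * s)"
      by (subst nn_integral_cmult_indicator) (auto simp: ennreal_mult s_def)
    finally have 2: "emeasure (distr ?D borel uminus) {x<..} = ennreal (pi * s)" .
    show "emeasure (distr lborel borel (\<lambda>v. - (cmod v)\<^sup>2)) {x<..} < \<infinity>"
      by (simp add: 1)
    show "emeasure (distr lborel borel (\<lambda>v. - (cmod v)\<^sup>2)) {x<..} = emeasure (distr ?D borel uminus) {x<..}"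
      by (simp add: 1 2)
  qed simp_all
  then have "distr (distr lborel borel (\<lambda>v. - (cmod v)\<^sup>2)) borel uminus = distr (distr ?D borel uminus) borel uminus"
    by simp
  moreover have "distr (distr lborel borel (\<lambda>v. - (cmod v)\<^sup>2)) borel uminus = distr lborel borel (\<lambda>v. (cmod v)\<^sup>2)"
    by (subst distr_distr) (simp_all add: o_def)
  moreover have "distr (distr ?D borel uminus) borel uminus = ?D"
    by (subst distr_distr) (simp_all add: o_def distr_id2)
  ultimately show ?thesis by simp
qed

lemma integral_radial:
  fixes f :: "real \<Rightarrow> 'b::{banach, second_countable_topology}"
  assumes [measurable]: "f \<in> borel_measurable borel"
  shows "(\<integral>v. f ((cmod v)\<^sup>2) \<partial>lborel) = pi *\<^sub>R (\<integral>t. indicator {0..} t *\<^sub>R f t \<partial>lborel)"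
proof -
  have "(\<integral>v. f ((cmod v)\<^sup>2) \<partial>lborel) = (\<integral>t. f t \<partial>distr lborel borel (\<lambda>v. (cmod v)\<^sup>2))"
    by (simp add: integral_distr)
  also have "\<dots> = (\<integral>t. (pi * indicator {0..} t) *\<^sub>R f t \<partial>lborel)"
    unfolding distr_lborel_cmod_square by (rule integral_density) auto
  also have "\<dots> = (\<integral>t. pi *\<^sub>R (indicator {0..} t *\<^sub>R f t) \<partial>lborel)"
    by simp
  also have "\<dots> = pi *\<^sub>R (\<integral>t. indicator {0..} t *\<^sub>R f t \<partial>lborel)"
    by (rule integral_scaleR_right) 
  finally show ?thesis .
qed

text \<open>
  The singularity \<open>1 / \<bar>u - a\<bar>\<close> is integrable in the plane: after the substitution \<open>t = \<bar>u - a\<bar>\<^sup>2\<close>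
  it becomes \<open>t powr (-1/2)\<close>, which is integrable at zero on the line.
\<close>
lemma integrable_indicator_over_cmod:
  "integrable lborel (\<lambda>u. indicator (ball 0 R) u / cmod (u - a))"
proof -
  have [measurable]: "ball (0::complex) R \<in> sets borel" by simp
  \<comment> \<open>\<open>S\<close> is chosen so that \<open>\<bar>u\<bar> < R\<close> implies \<open>\<bar>u - a\<bar>\<^sup>2 \<le> S\<close>; the maximum covers negative \<open>R\<close>.\<close>
  define S where "S = (max 0 R + cmod a)\<^sup>2"
  define k where "k = (\<lambda>t::real. t powr (-1/2) * indicator {0..S} t)"
  have k_nonneg: "0 \<le> k t" for t by (simp add: k_def)
  have [measurable]: "k \<in> borel_measurable borel" by (simp add: k_def)
  have "((\<lambda>t. t powr (-1/2)) has_integral (S powr (-1/2+1) / (-1/2+1))) {0..S}"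
    by (rule has_integral_powr_from_0) (auto simp: S_def)
  then have fin: "(\<integral>\<^sup>+t. ennreal (t powr (-1/2)) * indicator {0..S} t \<partial>lborel) = ennreal (S powr (-1/2+1) / (-1/2+1))"
    by (rule nn_integral_has_integral_lebesgue'[rotated]) simp
  have "(\<integral>\<^sup>+v. ennreal (k ((cmod v)\<^sup>2)) \<partial>lborel) = (\<integral>\<^sup>+t. ennreal (k t) \<partial>distr lborel borel (\<lambda>v. (cmod v)\<^sup>2))"
    by (rule nn_integral_distr[symmetric]) auto
  also have "\<dots> = (\<integral>\<^sup>+t. ennreal (pi * indicator {0..} t) * ennreal (k t) \<partial>lborel)"
    unfolding distr_lborel_cmod_square by (rule nn_integral_density) auto
  also have "\<dots> = (\<integral>\<^sup>+t. ennreal pi * (ennreal (t powr (-1/2)) * indicator {0..S} t) \<partial>lborel)"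
    by (intro nn_integral_cong) (auto simp: indicator_def k_def)
  also have "\<dots> = ennreal pi * ennreal (S powr (-1/2+1) / (-1/2+1))"
    using fin by (simp add: nn_integral_cmult)
  also have "\<dots> < \<infinity>"
    by (simp add: ennreal_mult_less_top)
  finally have "integrable lborel (\<lambda>v::complex. k ((cmod v)\<^sup>2))"
    by (intro integrableI_bounded) (auto simp: k_nonneg)
  then have "integrable (distr lborel borel ((+) (- a))) (\<lambda>v::complex. k ((cmod v)\<^sup>2))"
    by (simp add: lborel_distr_plus)
  then have "integrable lborel (\<lambda>u::complex. k ((cmod (- a + u))\<^sup>2))"
    by (subst (asm) integrable_distr_eq) auto
  then show ?thesis
  proof (rule Bochner_Integration.integrable_bound)
    show "AE u in lborel. norm (indicator (ball 0 R) u / cmod (u - a)) \<le> norm (k ((cmod (- a + u))\<^sup>2))"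
    proof (rule AE_I2)
      fix u
      have "indicator (ball 0 R) u / cmod (u - a) \<le> k ((cmod (u - a))\<^sup>2)"
      proof (cases "u \<in> ball 0 R")
        case True
        then have "cmod (u - a) \<le> max 0 R + cmod a"
          using norm_triangle_ineq4[of u a] by auto
        then have "(cmod (u - a))\<^sup>2 \<le> S"
          unfolding S_def by (rule power_mono) simp
        moreover have "((cmod (u - a))\<^sup>2) powr (-1/2) = 1 / cmod (u - a)"
          by (cases "u = a") (simp_all add: powr_minus_divide powr_half_sqrt)
        ultimately show ?thesis
          using True by (simp add: k_def)
      qed (simp add: k_nonneg)
      then show "norm (indicator (ball 0 R) u / cmod (u - a)) \<le> norm (k ((cmod (- a + u))\<^sup>2))"
        by (simp add: k_nonneg)
    qed
  qed measurable
qed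

text \<open>
  Rotation preserves the integral and \<open>odd\<close> negates it; a function that is not integrable has
  integral 0 by convention.
\<close>
lemma integral_odd_under_rotation:
  fixes f :: "complex \<Rightarrow> complex"
  assumes [measurable]: "f \<in> borel_measurable borel" 
    and w: "cmod w = 1" and odd: "\<And>v. f (w * v) = - f v"
  shows "(\<integral>v. f v \<partial>lborel) = 0"
proof -
  have "(\<integral>v. f v \<partial>lborel) = (\<integral>v. f v \<partial>distr lborel borel (\<lambda>v. w * v))"
    by (simp add: distr_lborel_rotation[OF w])
  also have "\<dots> = (\<integral>v. f (w * v) \<partial>lborel)"
    by (rule integral_distr) auto
  also have "\<dots> = - (\<integral>v. f v \<partial>lborel)"
    by (simp add: odd)
  finally show ?thesis by simp
qed

text \<open>
  Orthogonality of the powers of \<open>v\<close> to radial functions: the rotation by \<open>pi / (n + 1)\<close> negates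
  \<open>v ^ (n + 1)\<close> and fixes \<open>\<bar>v\<bar>\<close>.
\<close>
lemma integral_radial_times_power:
  fixes k :: "real \<Rightarrow> complex"
  assumes [measurable]: "k \<in> borel_measurable borel"
  shows "(\<integral>v. k (cmod v) * v ^ Suc n \<partial>lborel) = 0"
    and "(\<integral>v. k (cmod v) * cnj v ^ Suc n \<partial>lborel) = 0"
proof -
  define w where "w = cis (pi / Suc n)"
  have w: "cmod w = 1" 
    by (simp add: w_def)
  have wn: "w ^ Suc n = -1"
    unfolding w_def Complex.DeMoivre by (simp del: of_nat_Suc)
  have cwn: "cnj w ^ Suc n = -1"
    using arg_cong[OF wn, of cnj] by (simp del: power_Suc)
  have [measurable]: "cnj \<in> borel_measurable borel"
    by (intro borel_measurable_continuous_onI continuous_intros)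
  show "(\<integral>v. k (cmod v) * v ^ Suc n \<partial>lborel) = 0"
    by (rule integral_odd_under_rotation[OF _ w])
       (simp_all add: norm_mult w power_mult_distrib wn del: power_Suc)
  show "(\<integral>v. k (cmod v) * cnj v ^ Suc n \<partial>lborel) = 0"
    by (rule integral_odd_under_rotation[OF _ w])
       (simp_all add: norm_mult w power_mult_distrib cwn del: power_Suc)
qed

section \<open>The kernel over concentric discs\<close>

text \<open>
  With \<open>t = \<bar>v\<bar>\<^sup>2\<close> this is \<open>pi\<close> times the integral of \<open>1 / (A\<^sup>2 + t)\<close>, whose primitive is
  \<open>Ln (1 + t / A\<^sup>2)\<close>. The principal branch is harmless because \<open>t < \<bar>A\<bar>\<^sup>2\<close> keeps the argument in the
  right half-plane.
\<close>
lemma integral_cball_radial_kernel: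
  fixes A :: complex
  assumes "0 < r" "r < cmod A"
  shows "(\<integral>v. indicator (cball 0 r) v *\<^sub>R (1 / (A\<^sup>2 + of_real ((cmod v)\<^sup>2))) \<partial>lborel)
    = of_real pi * Ln (1 + of_real (r\<^sup>2) / A\<^sup>2)"
proof -
  have "A \<noteq> 0" using assms by auto
  have lt: "t < (cmod A)\<^sup>2" if "t \<in> {0..r\<^sup>2}" for t
  proof -
    have "r\<^sup>2 < (cmod A)\<^sup>2" using assms by (intro power_strict_mono) auto
    with that show ?thesis by auto
  qed
  have Re_pos: "0 < Re (1 + of_real t / A\<^sup>2)" if "t \<in> {0..r\<^sup>2}" for t
  proof -
    have "cmod (of_real t / A\<^sup>2) < 1"
      using that lt[OF that] \<open>A \<noteq> 0\<close> by (simp add: norm_divide norm_power divide_less_eq)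
    then show ?thesis
      using abs_Re_le_cmod[of "of_real t / A\<^sup>2"] by simp
  qed
  have ne: "A\<^sup>2 + of_real t \<noteq> 0" if "t \<in> {0..r\<^sup>2}" for t
  proof
    assume "A\<^sup>2 + of_real t = 0"
    then have "1 + of_real t / A\<^sup>2 = 0" using \<open>A \<noteq> 0\<close> by (simp add: divide_simps add.commute)
    then show False using Re_pos[OF that] by simp
  qed
  define f where "f t = indicator {0..r\<^sup>2} t *\<^sub>R (1 / (A\<^sup>2 + of_real t))" for t :: real
  have [measurable]: "f \<in> borel_measurable borel" unfolding f_def by measurable
  have "(\<integral>v. indicator (cball 0 r) v *\<^sub>R (1 / (A\<^sup>2 + of_real ((cmod v)\<^sup>2))) \<partial>lborel) = (\<integral>v. f ((cmod v)\<^sup>2) \<partial>lborel)"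
  proof (intro Bochner_Integration.integral_cong refl)
    fix v
    have "cmod v \<le> r \<longleftrightarrow> (cmod v)\<^sup>2 \<le> r\<^sup>2"
      using assms(1) abs_le_square_iff[of "cmod v" r] by simp
    then show "indicator (cball 0 r) v *\<^sub>R (1 / (A\<^sup>2 + of_real ((cmod v)\<^sup>2))) = f ((cmod v)\<^sup>2)"
      by (simp add: f_def indicator_def)
  qed
  also have "\<dots> = pi *\<^sub>R (\<integral>t. indicator {0..} t *\<^sub>R f t \<partial>lborel)"
    by (rule integral_radial) measurable
  also have "(\<integral>t. indicator {0..} t *\<^sub>R f t \<partial>lborel) = (\<integral>t. indicator {0..r\<^sup>2} t *\<^sub>R (1 / (A\<^sup>2 + of_real t)) \<partial>lborel)"
    by (intro Bochner_Integration.integral_cong) (auto simp: f_def indicator_def)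
  also have "\<dots> = Ln (1 + of_real (r\<^sup>2) / A\<^sup>2) - Ln (1 + of_real 0 / A\<^sup>2)"
  proof (rule integral_FTC_Icc)
    fix t :: real assume t: "0 \<le> t" "t \<le> r\<^sup>2"
    have nn: "1 + of_real t / A\<^sup>2 \<notin> \<real>\<^sub>\<le>\<^sub>0"
      using Re_pos[of t] t by (auto simp: complex_nonpos_Reals_iff)
    have "((\<lambda>z. Ln (1 + z / A\<^sup>2)) has_field_derivative (1 / (A\<^sup>2 + of_real t))) (at (of_real t))"
      using nn \<open>A \<noteq> 0\<close> ne[of t] t
      by (auto intro!: derivative_eq_intros simp: field_simps)
    then have "((\<lambda>t. Ln (1 + of_real t / A\<^sup>2)) has_vector_derivative (1 / (A\<^sup>2 + of_real t))) (at t)"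
      by (rule has_vector_derivative_real_field)
    then show "((\<lambda>t. Ln (1 + of_real t / A\<^sup>2)) has_vector_derivative (1 / (A\<^sup>2 + of_real t))) (at t within {0..r\<^sup>2})"
      by (rule has_vector_derivative_at_within)
  next
    show "continuous_on {0..r\<^sup>2} (\<lambda>t. 1 / (A\<^sup>2 + of_real t))"
      using ne by (auto intro!: continuous_intros)
  qed simp
  finally show ?thesis by (simp add: scaleR_conv_of_real)
qed

text \<open>
  The partial-fraction identity
  \<open>(A\<^sup>2 + \<bar>v\<bar>\<^sup>2) / ((A + cnj v) * (A - v)) = 1 + v / (A - v) - cnj v / (A + cnj v)\<close>
  splits the integrand into the radial function \<open>- 1 / (A\<^sup>2 + \<bar>v\<bar>\<^sup>2)\<close> times one plus a power series in
  \<open>v\<close> and one in \<open>cnj v\<close>, neither with a constant term. Rotation kills every power, and only the radial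
  part contributes. The strict inequality \<open>r < \<bar>A\<bar>\<close> makes both series geometric with ratio at most
  \<open>r / \<bar>A\<bar> < 1\<close>, which justifies integrating term by term.
\<close>
lemma integral_cball_kernel:
  fixes A :: complex
  assumes r: "0 < r" "r < cmod A"
  shows "(\<integral>v. indicator (cball 0 r) v *\<^sub>R (1 / ((A + cnj v) * (v - A))) \<partial>lborel)
    = - of_real pi * Ln (1 + of_real (r\<^sup>2) / A\<^sup>2)"
proof -
  have "A \<noteq> 0" using r by auto
  define q where "q = r / cmod A"
  have q: "0 < q" "q < 1" using r \<open>A \<noteq> 0\<close> by (simp_all add: q_def)
  define k where "k t = indicator {..r} t *\<^sub>R (1 / (A\<^sup>2 + of_real (t\<^sup>2)))" for t :: real
  define C where "C = 1 / ((cmod A)\<^sup>2 - r\<^sup>2)"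
  have rr: "r\<^sup>2 < (cmod A)\<^sup>2" using r by (intro power_strict_mono) auto
  then have "C > 0" by (simp add: C_def)
  have [measurable]: "k \<in> borel_measurable borel" unfolding k_def by measurable
  have [measurable]: "cnj \<in> borel_measurable borel"
    by (intro borel_measurable_continuous_onI continuous_intros)
  have [measurable]: "cball (0::complex) r \<in> sets borel" by simp
  \<comment> \<open>The terms of the two geometric series, paired; \<open>Suc n\<close> because neither has a constant term.\<close>
  define F where "F n v = k (cmod v) * ((v / A) ^ Suc n + (- cnj v / A) ^ Suc n)" for n v
  have k_eq: "k (cmod v) = indicator (cball 0 r) v *\<^sub>R (1 / (A\<^sup>2 + of_real ((cmod v)\<^sup>2)))" for v
    by (simp add: k_def indicator_def)
  have k_bound: "norm (k (cmod v)) \<le> C * indicator (cball 0 r) v" for v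
  proof (cases "v \<in> cball 0 r")
    case True
    then have v: "(cmod v)\<^sup>2 \<le> r\<^sup>2" by (intro power_mono) auto
    have "(cmod A)\<^sup>2 - (cmod v)\<^sup>2 \<le> cmod (A\<^sup>2 + of_real ((cmod v)\<^sup>2))"
      using norm_diff_ineq[of "A\<^sup>2" "of_real ((cmod v)\<^sup>2)"] by (simp add: norm_power)
    then have "(cmod A)\<^sup>2 - r\<^sup>2 \<le> cmod (A\<^sup>2 + of_real ((cmod v)\<^sup>2))" using v by linarith
    then show ?thesis using True rr unfolding k_eq C_def 
      by (simp add: norm_divide frac_le del: of_real_power)
  qed (simp add: k_eq)
  have pow_bound: "norm (k (cmod v) * (v / A) ^ Suc n) \<le> C * q ^ Suc n * indicator (cball 0 r) v"
      "norm (k (cmod v) * (- cnj v / A) ^ Suc n) \<le> C * q ^ Suc n * indicator (cball 0 r) v" for n v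
  proof -
    have "norm (k (cmod v)) * (cmod v / cmod A) ^ Suc n \<le> C * indicator (cball 0 r) v * q ^ Suc n"
    proof (cases "v \<in> cball 0 r")
      case True
      then have "(cmod v / cmod A) ^ Suc n \<le> q ^ Suc n"
        unfolding q_def by (intro power_mono divide_right_mono) auto
      then show ?thesis
        using k_bound[of v] \<open>C > 0\<close> by (intro mult_mono) auto
    qed (simp add: k_eq)
    then show "norm (k (cmod v) * (v / A) ^ Suc n) \<le> C * q ^ Suc n * indicator (cball 0 r) v"
      "norm (k (cmod v) * (- cnj v / A) ^ Suc n) \<le> C * q ^ Suc n * indicator (cball 0 r) v"
      by (simp_all add: norm_mult norm_divide norm_power mult_ac del: power_Suc)
  qed
  have int_ind: "integrable lborel (\<lambda>v. c * indicator (cball (0::complex) r) v)" for c :: real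
    using emeasure_lborel_cball_finite[of "0::complex" r]
    by (intro integrable_mult_right integrable_real_indicator) auto
  have int_k: "integrable lborel (\<lambda>v. k (cmod v))"
    by (rule Bochner_Integration.integrable_bound[OF int_ind[of C]])
       (use k_bound \<open>C > 0\<close> in auto)
  have int1: "integrable lborel (\<lambda>v. k (cmod v) * (v / A) ^ Suc n)" for n
    by (rule Bochner_Integration.integrable_bound[OF int_ind[of "C * q ^ Suc n"]])
       (use pow_bound(1)[of _ n] \<open>C > 0\<close> q in \<open>auto simp del: power_Suc\<close>)
  have int2: "integrable lborel (\<lambda>v. k (cmod v) * (- cnj v / A) ^ Suc n)" for n
    by (rule Bochner_Integration.integrable_bound[OF int_ind[of "C * q ^ Suc n"]])
       (use pow_bound(2)[of _ n] \<open>C > 0\<close> q in \<open>auto simp del: power_Suc\<close>)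
  have int_F: "integrable lborel (F n)" for n
    unfolding F_def distrib_left using int1 int2 by (rule Bochner_Integration.integrable_add)
  have zero1: "(\<integral>v. k (cmod v) * (v / A) ^ Suc n \<partial>lborel) = 0" for n
    using integral_radial_times_power(1)[of "\<lambda>t. k t * (1 / A) ^ Suc n" n]
    by (simp add: power_divide mult_ac del: power_Suc)
  have zero2: "(\<integral>v. k (cmod v) * (- cnj v / A) ^ Suc n \<partial>lborel) = 0" for n
  proof -
    have "- cnj v / A = (- 1 / A) * cnj v" for v by simp
    then have "(- cnj v / A) ^ Suc n = (- 1 / A) ^ Suc n * cnj v ^ Suc n" for v
      by (simp only: power_mult_distrib)
    then show ?thesis
      using integral_radial_times_power(2)[of "\<lambda>t. k t * (- 1 / A) ^ Suc n" n]
      by (simp only: mult.assoc) simp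
  qed
  have zero: "(\<integral>v. F n v \<partial>lborel) = 0" for n
    unfolding F_def distrib_left using Bochner_Integration.integral_add[OF int1[of n] int2[of n]]
    unfolding zero1 zero2 by simp
  have F_bound: "norm (F n v) \<le> 2 * C * q ^ Suc n * indicator (cball 0 r) v" for n v
    unfolding F_def distrib_left
    using pow_bound(1)[of v n] pow_bound(2)[of v n] by (intro order_trans[OF norm_triangle_ineq]) linarith
  have sum_q: "summable (\<lambda>n. c * q ^ Suc n)" for c
    using q by (intro summable_mult) (simp add: summable_Suc_iff summable_geometric)
  have sumF: "summable (\<lambda>n. norm (F n v))" for v
  proof (rule summable_comparison_test'[OF sum_q[of "2 * C"]])
    fix n :: nat
    have "2 * C * q ^ Suc n * indicator (cball 0 r) v \<le> 2 * C * q ^ Suc n"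
      using \<open>C > 0\<close> q by (simp add: indicator_def)
    then show "norm (norm (F n v)) \<le> 2 * C * q ^ Suc n" using F_bound[of n v] by simp
  qed
  have sumI: "summable (\<lambda>n. \<integral>v. norm (F n v) \<partial>lborel)"
  proof (rule summable_comparison_test'[OF sum_q[of "2 * C * measure lborel (cball (0::complex) r)"]])
    fix n :: nat
    have "(\<integral>v. norm (F n v) \<partial>lborel) \<le> (\<integral>v. 2 * C * q ^ Suc n * indicator (cball (0::complex) r) v \<partial>lborel)"
      by (intro Bochner_Integration.integral_mono integrable_norm int_F int_ind F_bound)
    also have "\<dots> = 2 * C * measure lborel (cball (0::complex) r) * q ^ Suc n"
      by simp
    finally show "norm (\<integral>v. norm (F n v) \<partial>lborel) \<le> 2 * C * measure lborel (cball (0::complex) r) * q ^ Suc n"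
      by simp
  qed
  have sums0: "(\<integral>v. (\<Sum>n. F n v) \<partial>lborel) = 0"
    using integral_suminf[OF int_F _ sumI] sumF zero by simp
  have intS: "integrable lborel (\<lambda>v. \<Sum>n. F n v)"
    using integrable_suminf[OF int_F _ sumI] sumF by simp
  have decomp: "indicator (cball 0 r) v *\<^sub>R (1 / ((A + cnj v) * (v - A))) = - (k (cmod v) + (\<Sum>n. F n v))" for v
  proof (cases "v \<in> cball 0 r")
    case False
    then show ?thesis by (simp add: F_def k_eq)
  next
    case True
    then have "cmod v < cmod A" using r by auto
    then have n1: "norm (v / A) < 1" and n2: "norm (- cnj v / A) < 1"
      using \<open>A \<noteq> 0\<close> by (simp_all add: norm_divide)
    have nz: "A - v \<noteq> 0" "A + cnj v \<noteq> 0" "A\<^sup>2 + v * cnj v \<noteq> 0"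
    proof -
      show "A - v \<noteq> 0" using \<open>cmod v < cmod A\<close> by auto
      show "A + cnj v \<noteq> 0" using \<open>cmod v < cmod A\<close> by (metis add_eq_0_iff complex_mod_cnj norm_minus_cancel less_irrefl)
      have "cmod (v * cnj v) < cmod (A\<^sup>2)"
        using \<open>cmod v < cmod A\<close> by (simp add: norm_mult norm_power power2_eq_square mult_strict_mono')
      then show "A\<^sup>2 + v * cnj v \<noteq> 0" by (metis add_eq_0_iff norm_minus_cancel less_irrefl)
    qed
    have g1: "(\<lambda>n. (v / A) ^ Suc n) sums (v / A * (1 / (1 - v / A)))"
      using sums_mult[OF geometric_sums[OF n1], of "v / A"] by simp
    have g2: "(\<lambda>n. (- cnj v / A) ^ Suc n) sums (- cnj v / A * (1 / (1 - (- cnj v / A))))"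
      using sums_mult[OF geometric_sums[OF n2], of "- cnj v / A"] by simp
    have "(\<lambda>n. F n v) sums (k (cmod v) * (v / A * (1 / (1 - v / A)) + (- cnj v / A * (1 / (1 - (- cnj v / A))))))"
      unfolding F_def by (rule sums_mult[OF sums_add[OF g1 g2]])
    then have S: "(\<Sum>n. F n v) = k (cmod v) * (v / A * (1 / (1 - v / A)) + (- cnj v / A * (1 / (1 - (- cnj v / A)))))"
      by (simp add: sums_iff)
    have e1: "v / A * (1 / (1 - v / A)) = v / (A - v)" using \<open>A \<noteq> 0\<close> nz by (simp add: field_simps)
    have e2: "- cnj v / A * (1 / (1 - (- cnj v / A))) = - cnj v / (A + cnj v)" using \<open>A \<noteq> 0\<close> nz by (simp add: field_simps)
    have kk: "k (cmod v) = 1 / (A\<^sup>2 + v * cnj v)"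
      using True complex_norm_square[of v] by (simp add: k_eq)
    have "1 + v / (A - v) + - cnj v / (A + cnj v) = (A\<^sup>2 + v * cnj v) / ((A + cnj v) * (A - v))"
      using nz by (simp add: divide_simps) (simp add: algebra_simps power2_eq_square)
    then have "k (cmod v) + (\<Sum>n. F n v) = 1 / (A\<^sup>2 + v * cnj v) * ((A\<^sup>2 + v * cnj v) / ((A + cnj v) * (A - v)))"
      unfolding S e1 e2 kk by (metis (no_types, lifting) add.assoc distrib_left mult.right_neutral)
    also have "\<dots> = 1 / ((A + cnj v) * (A - v))"
      using nz by simp
    also have "\<dots> = - (1 / ((A + cnj v) * (v - A)))"
      using nz by (simp add: divide_simps)
    finally show ?thesis using True by simp
  qed
  have "(\<integral>v. indicator (cball 0 r) v *\<^sub>R (1 / ((A + cnj v) * (v - A))) \<partial>lborel) = - ((\<integral>v. k (cmod v) \<partial>lborel) + (\<integral>v. (\<Sum>n. F n v) \<partial>lborel))"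
    unfolding decomp using int_k intS by simp
  also have "\<dots> = - of_real pi * Ln (1 + of_real (r\<^sup>2) / A\<^sup>2)"
    unfolding sums0 k_eq integral_cball_radial_kernel[OF r] by simp
  finally show ?thesis .
qed

section \<open>Integrability of the kernel\<close>

definition kernel :: "complex \<Rightarrow> complex" where
  "kernel u = 1 / (cnj (u + 1) * (u - 1))"

lemma I_integrand_eq: "I_integrand g u = of_real (g u) * kernel u"
  by (simp add: I_integrand_def kernel_def)

lemma borel_measurable_kernel [measurable]: "kernel \<in> borel_measurable borel"
proof -
  have [measurable]: "cnj \<in> borel_measurable borel"
    by (intro borel_measurable_continuous_onI continuous_intros)
  show ?thesis unfolding kernel_def [abs_def] by measurable
qed

text \<open>
  The two singular points are at distance 2, so \<open>1 / (a * b) \<le> 1 / a + 1 / b\<close> holds for the distances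
  \<open>a\<close>, \<open>b\<close> to them because \<open>a + b \<ge> 2\<close>.
\<close>
lemma norm_kernel_le: "cmod (kernel u) \<le> 1 / cmod (u - 1) + 1 / cmod (u - (- 1))"
proof (cases "u = 1 \<or> u = -1")
  case True
  then show ?thesis by (auto simp: kernel_def)
next
  case False
  have "2 \<le> cmod (u - 1) + cmod (u + 1)"
    using norm_triangle_ineq4[of "u + 1" "u - 1"] by simp
  moreover have "0 < cmod (u - 1)" "0 < cmod (u + 1)"
    using False by (auto simp: add_eq_0_iff2)
  ultimately show ?thesis
    by (simp add: kernel_def norm_divide norm_mult divide_simps complex_mod_cnj del: complex_cnj_add)
qed

lemma integrable_indicator_kernel: "integrable lborel (\<lambda>u. indicator (ball 0 R) u * cmod (kernel u))"
proof -
  have [measurable]: "ball (0::complex) R \<in> sets borel" by simp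
  have "integrable lborel (\<lambda>u. indicator (ball 0 R) u / cmod (u - 1) + indicator (ball 0 R) u / cmod (u - (- 1)))"
    by (intro Bochner_Integration.integrable_add integrable_indicator_over_cmod)
  then show ?thesis
  proof (rule Bochner_Integration.integrable_bound)
    show "AE u in lborel. norm (indicator (ball 0 R) u * cmod (kernel u))
      \<le> norm (indicator (ball 0 R) u / cmod (u - 1) + indicator (ball 0 R) u / cmod (u - (- 1)))"
      using norm_kernel_le by (intro AE_I2) (auto simp: indicator_def)
  qed measurable
qed

text \<open>
  The complement of the essential support is a union of possibly uncountably many open sets on which
  \<open>g\<close> vanishes almost everywhere; the Lindelof property reduces it to a countable union.
\<close>
lemma G1_vanishes_outside_ball:
  assumes "g \<in> G1"
  obtains R where "AE u in lebesgue. u \<notin> ball 0 R \<longrightarrow> g u = 0"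
proof -
  define \<U> where "\<U> = {U. open U \<and> (AE u in lebesgue. u \<in> U \<longrightarrow> g u = 0)}"
  obtain \<V> where \<V>: "\<V> \<subseteq> \<U>" "countable \<V>" "\<Union>\<V> = \<Union>\<U>"
    using Lindelof[of \<U>] by (auto simp: \<U>_def)
  have "AE u in lebesgue. \<forall>U\<in>\<V>. u \<in> U \<longrightarrow> g u = 0"
    using \<V> by (subst AE_ball_countable) (auto simp: \<U>_def)
  then have AE: "AE u in lebesgue. u \<in> \<Union>\<U> \<longrightarrow> g u = 0"
    by eventually_elim (use \<V>(3) in auto)
  have supp: "ess_support g = - \<Union>\<U>" by (simp add: ess_support_def \<U>_def)
  have "bounded (ess_support g)"
    using assms by (simp add: G1_def compact_imp_bounded)
  then obtain R where "ess_support g \<subseteq> ball 0 R"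
    using bounded_subset_ballD by blast
  with AE supp have "AE u in lebesgue. u \<notin> ball 0 R \<longrightarrow> g u = 0"
    by (auto elim!: eventually_mono)
  then show thesis by (rule that)
qed

lemma integrable_I_integrand:
  assumes "g \<in> G1"
  shows "integrable lebesgue (I_integrand g)"
proof -
  obtain R where R: "AE u in lebesgue. u \<notin> ball 0 R \<longrightarrow> g u = 0"
    using G1_vanishes_outside_ball[OF assms] .
  have [measurable]: "g \<in> borel_measurable lebesgue" using assms by (simp add: G1_def)
  have [measurable]: "kernel \<in> borel_measurable lebesgue"
    by (rule measurable_completion) simp
  have bd: "AE u in lebesgue. 0 \<le> g u \<and> g u \<le> 1" using assms by (simp add: G1_def)
  have "integrable lebesgue (\<lambda>u. indicator (ball 0 R) u * cmod (kernel u))"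
    by (subst integrable_completion) (use integrable_indicator_kernel[of R] in auto)
  then show ?thesis
  proof (rule Bochner_Integration.integrable_bound)
    show "AE u in lebesgue. norm (I_integrand g u) \<le> norm (indicator (ball 0 R) u * cmod (kernel u))"
      using R bd
    proof eventually_elim
      case (elim u)
      then show ?case
        by (cases "u \<in> ball 0 R") (auto simp: I_integrand_eq norm_mult intro: mult_left_le_one_le)
    qed
    show "I_integrand g \<in> borel_measurable lebesgue"
      unfolding I_integrand_eq[abs_def] by measurable
  qed
qed

lemma g_disc_in_G1: "g_disc \<theta> \<in> G1"
proof -
  have [measurable]: "disc_D \<theta> \<in> sets lebesgue" by (simp add: disc_D_def)
  have "open (- closure (disc_D \<theta>)) \<and> (AE u in lebesgue. u \<in> - closure (disc_D \<theta>) \<longrightarrow> g_disc \<theta> u = 0)"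
    using closure_subset[of "disc_D \<theta>"] by (auto simp: g_disc_def indicator_def intro!: AE_I2)
  then have "ess_support (g_disc \<theta>) \<subseteq> closure (disc_D \<theta>)"
    unfolding ess_support_def by blast
  then have "bounded (ess_support (g_disc \<theta>))"
    by (rule bounded_subset[rotated]) (simp add: disc_D_def bounded_closure)
  moreover have "closed (ess_support (g_disc \<theta>))"
    unfolding ess_support_def closed_def by auto
  ultimately show ?thesis
    by (auto simp: G1_def compact_eq_bounded_closed g_disc_def)
qed

section \<open>Values at the extremal discs\<close>

definition boundary_point :: "real \<Rightarrow> complex" where
  "boundary_point \<theta> = of_real (ln (2 * sin \<theta>)) + \<i> * of_real (pi / 2 - \<theta>)"

text \<open>
  The right-hand side is \<open>1 - exp (- 2 * \<i> * \<theta>)\<close>, a point of the circle of radius 1 about 1.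
\<close>
lemma exp_boundary_point:
  assumes "0 < \<theta>" "\<theta> < pi"
  shows "exp (boundary_point \<theta>) = of_real (2 * sin \<theta>) * (of_real (sin \<theta>) + \<i> * of_real (cos \<theta>))"
  using sin_gt_zero[OF assms]
  by (simp add: boundary_point_def complex_eq_iff Re_exp Im_exp cos_diff sin_diff)

text \<open>
  The kernel is singular at \<open>1\<close> and \<open>-1\<close>, which lie on the boundary of the disc, so the power series
  argument applies only to smaller concentric discs; dominated convergence then fills the disc. With
  \<open>c = \<i> cot \<theta>\<close> and \<open>A = 1 - c\<close> one has \<open>cnj (c + 1) = A\<close> and \<open>\<bar>A\<bar> = 1 / sin \<theta>\<close>, the radius, which puts
  the translated kernel into the form of \<open>integral_cball_kernel\<close>. In the limit the argument of the
  logarithm is \<open>1 + (R / A)\<^sup>2 = 1 - exp (- 2 * \<i> * \<theta>)\<close>.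
\<close>
lemma I_val_disc:
  assumes \<theta>: "0 < \<theta>" "\<theta> < pi"
  shows "I_val (g_disc \<theta>) = boundary_point \<theta>"
proof -
  have s: "0 < sin \<theta>" using sin_gt_zero[OF \<theta>] .
  define c where "c = \<i> * complex_of_real (cot \<theta>)"
  define R where "R = 1 / sin \<theta>"
  define A where "A = 1 - c"
  define r where "r n = R * (1 - 1 / real (n + 2))" for n :: nat
  have "R > 0" using s by (simp add: R_def)
  have A_eq: "A = (of_real (sin \<theta>) - \<i> * of_real (cos \<theta>)) / of_real (sin \<theta>)"
    using s by (simp add: A_def c_def cot_def field_simps)
  have "cmod (of_real (sin \<theta>) - \<i> * of_real (cos \<theta>)) = 1"
    by (simp add: cmod_def)
  then have "cmod A = R"
    unfolding A_eq norm_divide R_def using s by simp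
  have r: "0 < r n" "r n < cmod A" "r n < R" for n
    using \<open>R > 0\<close> \<open>cmod A = R\<close> by (auto simp: r_def)
  have rlim: "r \<longlonglongrightarrow> R"
  proof -
    have "(\<lambda>n. R * (1 - 1 / real (n + 2))) \<longlonglongrightarrow> R * (1 - 0)"
      by (intro tendsto_intros LIMSEQ_ignore_initial_segment[OF lim_1_over_n])
    then show ?thesis by (simp add: r_def[abs_def])
  qed
  define q where "q = complex_of_real (sin \<theta>) + \<i> * of_real (cos \<theta>)"
  have "(complex_of_real (sin \<theta>) - \<i> * of_real (cos \<theta>)) * q = 1"
    by (simp add: q_def complex_eq_iff algebra_simps flip: power2_eq_square)
  then have qA: "of_real R / A = q"
    using s unfolding A_eq R_def by (simp add: divide_simps split: if_splits) (simp add: mult.commute)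
  have end_val: "1 + of_real (R\<^sup>2) / A\<^sup>2 = exp (boundary_point \<theta>)"
  proof -
    have "1 + of_real (R\<^sup>2) / A\<^sup>2 = 1 + q\<^sup>2"
      unfolding qA[symmetric] by (simp add: power_divide)
    also have "\<dots> = of_real (2 * sin \<theta>) * (of_real (sin \<theta>) + \<i> * of_real (cos \<theta>))"
      using sin_cos_squared_add[of \<theta>]
      by (simp add: q_def complex_eq_iff power2_eq_square algebra_simps)
    finally show ?thesis by (simp add: exp_boundary_point[OF \<theta>])
  qed
  have Re_end: "0 < Re (1 + of_real (R\<^sup>2) / A\<^sup>2)"
    unfolding end_val exp_boundary_point[OF \<theta>] using s by simp
  have [measurable]: "ball c R \<in> sets borel" "cball c t \<in> sets borel" "ball (0::complex) t \<in> sets borel" "cball (0::complex) t \<in> sets borel" for t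
    by simp_all
  have int_n: "(\<integral>u. indicator (cball c (r n)) u *\<^sub>R kernel u \<partial>lborel) = - of_real pi * Ln (1 + of_real ((r n)\<^sup>2) / A\<^sup>2)" for n
  proof -
    have "(\<integral>u. indicator (cball c (r n)) u *\<^sub>R kernel u \<partial>lborel)
        = (\<integral>u. indicator (cball c (r n)) u *\<^sub>R kernel u \<partial>distr lborel borel ((+) c))"
      by (simp add: lborel_distr_plus)
    also have "\<dots> = (\<integral>v. indicator (cball c (r n)) (c + v) *\<^sub>R kernel (c + v) \<partial>lborel)"
      by (rule integral_distr) auto
    also have "\<dots> = (\<integral>v. indicator (cball 0 (r n)) v *\<^sub>R (1 / ((A + cnj v) * (v - A))) \<partial>lborel)"
      by (intro Bochner_Integration.integral_cong refl)
         (auto simp: indicator_def dist_norm kernel_def A_def c_def algebra_simps)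
    finally show ?thesis using integral_cball_kernel[OF r(1,2)] by simp
  qed
  have "(\<lambda>n. - of_real pi * Ln (1 + of_real ((r n)\<^sup>2) / A\<^sup>2)) \<longlonglongrightarrow> - of_real pi * Ln (1 + of_real (R\<^sup>2) / A\<^sup>2)"
    using Re_end \<open>R > 0\<close> \<open>cmod A = R\<close>
    by (intro tendsto_intros rlim) (auto simp: complex_nonpos_Reals_iff)
  moreover have "(\<lambda>n. \<integral>u. indicator (cball c (r n)) u *\<^sub>R kernel u \<partial>lborel) \<longlonglongrightarrow> (\<integral>u. indicator (ball c R) u *\<^sub>R kernel u \<partial>lborel)"
  proof (rule integral_dominated_convergence)
    show "integrable lborel (\<lambda>u. indicator (ball 0 (R + cmod c)) u * cmod (kernel u))"
      by (rule integrable_indicator_kernel)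
    show "AE u in lborel. (\<lambda>n. indicator (cball c (r n)) u *\<^sub>R kernel u) \<longlonglongrightarrow> indicator (ball c R) u *\<^sub>R kernel u"
    proof (rule AE_I2)
      fix u
      have "\<forall>\<^sub>F n in sequentially. indicator (cball c (r n)) u *\<^sub>R kernel u = indicator (ball c R) u *\<^sub>R kernel u"
      proof (cases "u \<in> ball c R")
        case True
        then have "\<forall>\<^sub>F n in sequentially. dist c u < r n"
          using order_tendstoD(1)[OF rlim] by simp
        then show ?thesis using True by (auto elim!: eventually_mono)
      next
        case False
        then have "u \<notin> cball c (r n)" for n
          using r(3)[of n] by auto
        with False show ?thesis by simp
      qed
      then show "(\<lambda>n. indicator (cball c (r n)) u *\<^sub>R kernel u) \<longlonglongrightarrow> indicator (ball c R) u *\<^sub>R kernel u"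
        by (rule tendsto_eventually)
    qed
    show "AE u in lborel. norm (indicator (cball c (r n)) u *\<^sub>R kernel u) \<le> indicator (ball 0 (R + cmod c)) u * cmod (kernel u)" for n
    proof (rule AE_I2)
      fix u
      have "u \<in> ball 0 (R + cmod c)" if "u \<in> cball c (r n)"
        using that r(3)[of n] norm_triangle_ineq2[of u c] by (auto simp: dist_norm norm_minus_commute)
      then show "norm (indicator (cball c (r n)) u *\<^sub>R kernel u) \<le> indicator (ball 0 (R + cmod c)) u * cmod (kernel u)"
        by (auto simp: indicator_def)
    qed
  qed measurable
  ultimately have "(\<integral>u. indicator (ball c R) u *\<^sub>R kernel u \<partial>lborel) = - of_real pi * Ln (1 + of_real (R\<^sup>2) / A\<^sup>2)"
    unfolding int_n using LIMSEQ_unique by blast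
  also have "Ln (1 + of_real (R\<^sup>2) / A\<^sup>2) = boundary_point \<theta>"
    unfolding end_val using \<theta> by (intro Ln_exp) (auto simp: boundary_point_def)
  finally have "(\<integral>u. indicator (ball c R) u *\<^sub>R kernel u \<partial>lborel) = - of_real pi * boundary_point \<theta>" .
  moreover have "(LINT u|lebesgue. I_integrand (g_disc \<theta>) u) = (\<integral>u. indicator (ball c R) u *\<^sub>R kernel u \<partial>lborel)"
    unfolding I_integrand_eq g_disc_def disc_D_def c_def[symmetric] R_def[symmetric] scaleR_conv_of_real
    by (rule integral_completion) measurable
  ultimately show ?thesis by (simp add: I_val_def)
qed

section \<open>Extremality of the discs\<close>

text \<open>
  If \<open>sin \<theta> > 0\<close>, the left-hand side is negative exactly inside the disc \<open>disc_D \<theta>\<close>: clearing denominators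
  leaves the power of \<open>u\<close> with respect to the boundary circle, times \<open>sin \<theta>\<close>. At \<open>u = 1\<close> and \<open>u = -1\<close>
  both sides are 0 by the convention for division by zero.
\<close>
lemma Im_cis_kernel:
  assumes "sin \<theta> \<noteq> 0"
  shows "Im (cis \<theta> * kernel u) = sin \<theta> * ((cmod (u - \<i> * cot \<theta>))\<^sup>2 - (1 / sin \<theta>)\<^sup>2) / ((cmod (u + 1))\<^sup>2 * (cmod (u - 1))\<^sup>2)"
proof -
  have "kernel u = (u + 1) * cnj (u - 1) / of_real ((cmod (u + 1))\<^sup>2 * (cmod (u - 1))\<^sup>2)"
  proof -
    have "1 / (cnj z * w) = z * cnj w / (z * cnj z * (w * cnj w))" for z w :: complex
      by (cases "z = 0"; cases "w = 0") simp_all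
    then show ?thesis unfolding kernel_def of_real_mult complex_norm_square .
  qed
  then have "Im (cis \<theta> * kernel u) = Im (cis \<theta> * ((u + 1) * cnj (u - 1))) / ((cmod (u + 1))\<^sup>2 * (cmod (u - 1))\<^sup>2)"
    by (simp only: times_divide_eq_right Im_divide_of_real)
  also have "Im (cis \<theta> * ((u + 1) * cnj (u - 1))) = sin \<theta> * ((Re u)\<^sup>2 + (Im u)\<^sup>2 - 1) - 2 * cos \<theta> * Im u"
    by (simp add: algebra_simps power2_eq_square)
  also have "\<dots> = sin \<theta> * ((cmod (u - \<i> * cot \<theta>))\<^sup>2 - (1 / sin \<theta>)\<^sup>2)"
  proof -
    have "(cmod (u - \<i> * cot \<theta>))\<^sup>2 = (Re u)\<^sup>2 + (Im u)\<^sup>2 - 2 * cot \<theta> * Im u + (cot \<theta>)\<^sup>2"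
      by (simp add: cmod_power2 power2_diff algebra_simps)
    moreover have "(cot \<theta>)\<^sup>2 = (1 / sin \<theta>)\<^sup>2 - 1"
      using assms sin_cos_squared_add[of \<theta>] by (simp add: cot_def field_simps)
    moreover have "sin \<theta> * cot \<theta> = cos \<theta>" using assms by (simp add: cot_def)
    ultimately have "(cmod (u - \<i> * cot \<theta>))\<^sup>2 - (1 / sin \<theta>)\<^sup>2 = (Re u)\<^sup>2 + (Im u)\<^sup>2 - 1 - 2 * cot \<theta> * Im u"
        and "sin \<theta> * (2 * cot \<theta> * Im u) = 2 * cos \<theta> * Im u"
      by simp_all
    then show ?thesis by (simp only: right_diff_distrib)
  qed
  finally show ?thesis .
qed

text \<open>
  The bathtub principle: to minimise the integral of \<open>g\<close> against a real weight under \<open>0 \<le> g \<le> 1\<close>, put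
  \<open>g = 1\<close> where the weight is negative and \<open>g = 0\<close> where it is positive. The weight vanishes only on a
  null set, so the minimiser is unique almost everywhere and every other \<open>g\<close> loses strictly.
\<close>
lemma Im_cis_I_val_less:
  assumes g: "g \<in> G1" and \<theta>: "0 < \<theta>" "\<theta> < pi" and ne: "\<not> ae_eq g (g_disc \<theta>)"
  shows "Im (cis \<theta> * I_val g) < Im (cis \<theta> * boundary_point \<theta>)"
proof -
  have s: "0 < sin \<theta>" using sin_gt_zero[OF \<theta>] .
  define k where "k u = Im (cis \<theta> * kernel u)" for u
  have k_eq: "k u = sin \<theta> * ((cmod (u - \<i> * cot \<theta>))\<^sup>2 - (1 / sin \<theta>)\<^sup>2) / ((cmod (u + 1))\<^sup>2 * (cmod (u - 1))\<^sup>2)" for u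
    unfolding k_def using s by (intro Im_cis_kernel) simp
  have pull: "integrable lebesgue (\<lambda>u. h u * k u)" 
      "Im (cis \<theta> * I_val h) = - (1 / pi) * (\<integral>u. h u * k u \<partial>lebesgue)" if "h \<in> G1" for h
  proof -
    have int: "integrable lebesgue (\<lambda>u. cis \<theta> * I_integrand h u)"
      using integrable_I_integrand[OF that] by simp
    have eq: "Im (cis \<theta> * I_integrand h u) = h u * k u" for u
      by (simp add: I_integrand_eq k_def algebra_simps)
    show "integrable lebesgue (\<lambda>u. h u * k u)"
      using integrable_Im[OF int] by (simp only: eq)
    have "cis \<theta> * I_val h = of_real (- (1 / pi)) * (\<integral>u. cis \<theta> * I_integrand h u \<partial>lebesgue)"
      by (simp add: I_val_def)
    then show "Im (cis \<theta> * I_val h) = - (1 / pi) * (\<integral>u. h u * k u \<partial>lebesgue)"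
    proof -
      have "Im (of_real c * z) = c * Im z" for c z by simp
      then show ?thesis using \<open>cis \<theta> * I_val h = _\<close> integral_Im[OF int] by (simp only: eq)
    qed
  qed
  define d where "d u = g u * k u - g_disc \<theta> u * k u" for u
  have int_d: "integrable lebesgue d"
    unfolding d_def by (intro Bochner_Integration.integrable_diff pull g g_disc_in_G1)
  have k_neg: "k u \<le> 0" if "u \<in> disc_D \<theta>" for u
  proof -
    have "(cmod (u - \<i> * cot \<theta>))\<^sup>2 \<le> (1 / sin \<theta>)\<^sup>2"
      using that by (intro power_mono) (auto simp: disc_D_def dist_norm norm_minus_commute)
    then show ?thesis using s
      by (auto simp: k_eq intro!: divide_nonpos_nonneg mult_nonneg_nonpos)
  qed
  have k_pos: "0 \<le> k u" if "u \<notin> disc_D \<theta>" for u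
  proof -
    have "(1 / sin \<theta>)\<^sup>2 \<le> (cmod (u - \<i> * cot \<theta>))\<^sup>2"
      using that s by (intro power_mono) (auto simp: disc_D_def dist_norm norm_minus_commute)
    then show ?thesis using s
      by (auto simp: k_eq)
  qed
  have d_nonneg: "AE u in lebesgue. 0 \<le> d u"
  proof -
    have "AE u in lebesgue. 0 \<le> g u \<and> g u \<le> 1" using g by (simp add: G1_def)
    then show ?thesis
    proof eventually_elim
      case (elim u)
      show ?case
      proof (cases "u \<in> disc_D \<theta>")
        case True
        then show ?thesis using elim mult_right_mono_neg[OF _ k_neg[OF True], of "g u" 1]
          by (simp add: d_def g_disc_def)
      next
        case False
        then show ?thesis using elim k_pos[OF False] by (simp add: d_def g_disc_def)
      qed
    qed
  qed
  have k_nz: "AE u in lebesgue. k u \<noteq> 0"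
  proof -
    have "AE u in lebesgue. u \<notin> sphere (\<i> * cot \<theta>) (1 / sin \<theta>) \<union> {1, -1}"
      using negligible_sphere by (intro AE_not_in) (auto simp: negligible_iff_null_sets[symmetric])
    then show ?thesis
    proof eventually_elim
      case (elim u)
      then have "cmod (u - \<i> * cot \<theta>) \<noteq> 1 / sin \<theta>" by (auto simp: dist_norm norm_minus_commute)
      then have "(cmod (u - \<i> * cot \<theta>))\<^sup>2 \<noteq> (1 / sin \<theta>)\<^sup>2" using s by (simp add: power2_eq_iff_nonneg)
      then show ?case using elim s by (auto simp: k_eq add_eq_0_iff2)
    qed
  qed
  have "(\<integral>u. d u \<partial>lebesgue) \<noteq> 0"
  proof
    assume "(\<integral>u. d u \<partial>lebesgue) = 0"
    then have "AE u in lebesgue. d u = 0"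
      using integral_nonneg_eq_0_iff_AE[OF int_d d_nonneg] by simp
    then have "AE u in lebesgue. g u = g_disc \<theta> u"
      using k_nz by eventually_elim (simp add: d_def)
    with ne show False by (simp add: ae_eq_def)
  qed
  with integral_nonneg_AE[OF d_nonneg] have "0 < (\<integral>u. d u \<partial>lebesgue)" by simp
  also have "(\<integral>u. d u \<partial>lebesgue) = (\<integral>u. g u * k u \<partial>lebesgue) - (\<integral>u. g_disc \<theta> u * k u \<partial>lebesgue)"
    unfolding d_def by (intro Bochner_Integration.integral_diff pull g g_disc_in_G1)
  finally have "Im (cis \<theta> * I_val g) < Im (cis \<theta> * I_val (g_disc \<theta>))"
    unfolding pull(2)[OF g] pull(2)[OF g_disc_in_G1] by (simp add: divide_strict_right_mono)
  then show ?thesis by (simp add: I_val_disc[OF \<theta>])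
qed

section \<open>The region as an intersection of half-planes\<close>

lemma cmod_exp_minus_one: "(cmod (exp z - 1))\<^sup>2 - 1 = exp (Re z) * (exp (Re z) - 2 * cos (Im z))"
proof -
  have "(cmod (exp z - 1))\<^sup>2 = (exp (Re z) * cos (Im z) - 1)\<^sup>2 + (exp (Re z) * sin (Im z))\<^sup>2"
    by (simp add: cmod_power2 Re_exp Im_exp)
  also have "\<dots> = (exp (Re z))\<^sup>2 * ((sin (Im z))\<^sup>2 + (cos (Im z))\<^sup>2) - 2 * exp (Re z) * cos (Im z) + 1"
    by (simp add: power2_diff power_mult_distrib algebra_simps del: sin_cos_squared_add sin_cos_squared_add2)
  finally show ?thesis by (simp add: algebra_simps power2_eq_square)
qed

lemma exp_in_disc_iff: "cmod (exp z - 1) < 1 \<longleftrightarrow> exp (Re z) < 2 * cos (Im z)"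
proof -
  have "cmod (exp z - 1) < 1 \<longleftrightarrow> (cmod (exp z - 1))\<^sup>2 - 1 < 0"
    by (simp add: abs_square_less_1)
  then show ?thesis
    unfolding cmod_exp_minus_one by (simp add: mult_less_0_iff)
qed

lemma exp_in_circle_iff: "cmod (exp z - 1) = 1 \<longleftrightarrow> exp (Re z) = 2 * cos (Im z)"
proof -
  have "cmod (exp z - 1) = 1 \<longleftrightarrow> (cmod (exp z - 1))\<^sup>2 - 1 = 0"
    by (simp add: abs_square_eq_1)
  then show ?thesis
    unfolding cmod_exp_minus_one by simp
qed

lemma Re_pos_if_cmod_minus_one_le_1:
  assumes "cmod (w - 1) \<le> 1" "w \<noteq> 0"
  shows "0 < Re w"
proof -
  have "(cmod (w - 1))\<^sup>2 \<le> 1" using assms(1) by (simp add: power_le_one)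
  then have "(Re w)\<^sup>2 + (Im w)\<^sup>2 \<le> 2 * Re w"
    by (simp add: cmod_power2 power2_diff)
  moreover have "0 < (Re w)\<^sup>2 + (Im w)\<^sup>2" using assms(2) by (simp add: complex_neq_0)
  ultimately show ?thesis by linarith
qed

text \<open>
  In the closed disc of radius 1 about 1, the origin is the only point with nonpositive real
  part. Hence \<open>Ln\<close> maps into the strip \<open>\<bar>Im z\<bar> < pi / 2\<close>, where it inverts \<open>exp\<close>.
\<close>
lemma Ln_image_eq:
  assumes "S \<subseteq> {w. cmod (w - 1) \<le> 1} - {0}"
  shows "Ln ` S = {z. \<bar>Im z\<bar> < pi / 2 \<and> exp z \<in> S}"
proof (intro equalityI subsetI)
  fix z assume "z \<in> Ln ` S"
  then obtain w where w: "w \<in> S" "z = Ln w" by blast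
  with assms have "w \<noteq> 0" "0 < Re w" by (auto intro: Re_pos_if_cmod_minus_one_le_1)
  with w show "z \<in> {z. \<bar>Im z\<bar> < pi / 2 \<and> exp z \<in> S}"
    using Re_Ln_pos_lt[of w] by simp
next
  fix z assume "z \<in> {z. \<bar>Im z\<bar> < pi / 2 \<and> exp z \<in> S}"
  moreover from this have "Ln (exp z) = z" by (intro Ln_exp) auto
  ultimately show "z \<in> Ln ` S" by (metis (mono_tags) image_eqI mem_Collect_eq)
qed

lemma Omega1_eq: "Omega1 = {z. \<bar>Im z\<bar> < pi / 2 \<and> exp (Re z) < 2 * cos (Im z)}"
  unfolding Omega1_def by (subst Ln_image_eq) (auto simp: exp_in_disc_iff)

lemma Gamma0_eq: "Gamma0 = {z. \<bar>Im z\<bar> < pi / 2 \<and> exp (Re z) = 2 * cos (Im z)}"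
  unfolding Gamma0_def by (subst Ln_image_eq) (auto simp: exp_in_circle_iff)

lemma Gamma0_eq_range_boundary_point: "Gamma0 = boundary_point ` {0<..<pi}"
proof (intro equalityI subsetI)
  fix z assume "z \<in> Gamma0"
  then have z: "\<bar>Im z\<bar> < pi / 2" "exp (Re z) = 2 * cos (Im z)" by (auto simp: Gamma0_eq)
  have "Re z = ln (2 * sin (pi / 2 - Im z))"
    using z(2) ln_exp[of "Re z"] by (simp add: sin_diff)
  then have "z = boundary_point (pi / 2 - Im z)"
    by (simp add: boundary_point_def complex_eq_iff)
  moreover have "pi / 2 - Im z \<in> {0<..<pi}" using z(1) by auto
  ultimately show "z \<in> boundary_point ` {0<..<pi}" by blast
next
  fix z assume "z \<in> boundary_point ` {0<..<pi}"
  then obtain \<theta> where \<theta>: "0 < \<theta>" "\<theta> < pi" "z = boundary_point \<theta>" by auto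
  then show "z \<in> Gamma0"
    using sin_gt_zero[of \<theta>] by (auto simp: Gamma0_eq boundary_point_def cos_diff abs_if)
qed

lemma open_Omega1: "open Omega1"
  unfolding Omega1_eq by (intro open_Collect_conj open_Collect_less continuous_intros)

text \<open>
  The closed conditions \<open>\<bar>Im z\<bar> \<le> pi / 2\<close> and \<open>exp (Re z) \<le> 2 * cos (Im z)\<close> add only the curve, because
  \<open>cos\<close> vanishes at the edges of the strip and \<open>exp\<close> does not. Conversely, moving a point of the curve to
  the left brings it into the region.
\<close>
lemma frontier_Omega1: "frontier Omega1 = Gamma0"
proof -
  have "closure Omega1 \<subseteq> Omega1 \<union> Gamma0"
  proof -
    let ?C = "{z. \<bar>Im z\<bar> \<le> pi / 2 \<and> exp (Re z) \<le> 2 * cos (Im z)}"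
    have "closed ?C" by (intro closed_Collect_conj closed_Collect_le continuous_intros)
    moreover have "Omega1 \<subseteq> ?C" by (auto simp: Omega1_eq)
    ultimately have "closure Omega1 \<subseteq> ?C" by (rule closure_minimal[rotated])
    also have "?C \<subseteq> Omega1 \<union> Gamma0"
    proof
      fix z assume z: "z \<in> ?C"
      have "\<bar>Im z\<bar> \<noteq> pi / 2"
      proof
        assume "\<bar>Im z\<bar> = pi / 2"
        then have "cos (Im z) = 0" by (metis cos_abs_real cos_pi_half)
        with z show False by (simp add: not_le)
      qed
      with z show "z \<in> Omega1 \<union> Gamma0" by (auto simp: Omega1_eq Gamma0_eq)
    qed
    finally show ?thesis .
  qed
  moreover have "Gamma0 \<subseteq> closure Omega1"
  proof
    fix z assume z: "z \<in> Gamma0"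
    have "(\<lambda>n. z - of_real (1 / real (Suc n))) \<longlonglongrightarrow> z - of_real 0"
      by (intro tendsto_intros LIMSEQ_Suc[OF lim_1_over_n])
    moreover have "z - of_real (1 / real (Suc n)) \<in> Omega1" for n
    proof -
      have "exp (Re z - 1 / real (Suc n)) < exp (Re z)" by (simp del: of_nat_Suc)
      with z show ?thesis by (simp add: Omega1_eq Gamma0_eq del: of_nat_Suc)
    qed
    ultimately show "z \<in> closure Omega1"
      unfolding closure_sequential by (intro exI[of _ "\<lambda>n. z - of_real (1 / real (Suc n))"]) auto
  qed
  moreover have "Gamma0 \<inter> Omega1 = {}" by (auto simp: Omega1_eq Gamma0_eq)
  moreover have "Omega1 \<subseteq> closure Omega1" by (rule closure_subset)
  ultimately show ?thesis
    unfolding frontier_def interior_open[OF open_Omega1] by blast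
qed

text \<open>
  The curve lies on one side of its tangent at \<open>boundary_point \<theta>\<close>: the extremal
  property of the disc \<open>disc_D \<theta>\<close>, tested against the competing disc \<open>disc_D t\<close>, says exactly this.
\<close>
lemma boundary_point_extremal:
  assumes \<theta>: "0 < \<theta>" "\<theta> < pi" and t: "0 < t" "t < pi"
  shows "Im (cis \<theta> * boundary_point t) \<le> Im (cis \<theta> * boundary_point \<theta>)"
proof (cases "ae_eq (g_disc t) (g_disc \<theta>)")
  case True
  have "(LINT u|lebesgue. I_integrand (g_disc t) u) = (LINT u|lebesgue. I_integrand (g_disc \<theta>) u)"
  proof (rule integral_cong_AE)
    show "AE u in lebesgue. I_integrand (g_disc t) u = I_integrand (g_disc \<theta>) u"
      using True unfolding ae_eq_def by eventually_elim (simp add: I_integrand_def)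
  qed (intro borel_measurable_integrable integrable_I_integrand g_disc_in_G1)+
  then have "I_val (g_disc t) = I_val (g_disc \<theta>)"
    by (simp add: I_val_def)
  then show ?thesis by (simp add: I_val_disc \<theta> t)
next
  case False
  from Im_cis_I_val_less[OF g_disc_in_G1 \<theta> False] show ?thesis by (simp add: I_val_disc t)
qed

text \<open>
  A point of the region lies to the left of the point \<open>boundary_point t\<close> at its own height, hence strictly
  inside every half-plane. Conversely, the half-plane tangent at that height gives the inequality for
  \<open>Re z\<close>, provided that the height is in \<open>(- pi / 2, pi / 2)\<close>. The half-planes for \<open>\<theta>\<close> near 0 and near
  \<open>pi\<close> exclude all other heights, because \<open>ln (2 * sin \<theta>)\<close> tends to minus infinity there.
\<close>
lemma Omega1_iff_half_planes:
  "z \<in> Omega1 \<longleftrightarrow> (\<forall>\<theta>\<in>{0<..<pi}. Im (cis \<theta> * z) < Im (cis \<theta> * boundary_point \<theta>))"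
proof
  assume z: "z \<in> Omega1"
  define t where "t = pi / 2 - Im z"
  have t: "0 < t" "t < pi" using z by (auto simp: t_def Omega1_eq)
  have "exp (Re z) < 2 * sin t" using z by (simp add: t_def Omega1_eq sin_diff)
  then have Re: "Re z < Re (boundary_point t)"
    using sin_gt_zero[OF t] exp_less_cancel_iff[of "Re z" "ln (2 * sin t)"]
    by (simp add: boundary_point_def)
  have Im: "Im z = Im (boundary_point t)" by (simp add: boundary_point_def t_def)
  show "\<forall>\<theta>\<in>{0<..<pi}. Im (cis \<theta> * z) < Im (cis \<theta> * boundary_point \<theta>)"
  proof
    fix \<theta> :: real assume "\<theta> \<in> {0<..<pi}"
    then have \<theta>: "0 < \<theta>" "\<theta> < pi" by auto
    have "Im (cis \<theta> * z) < Im (cis \<theta> * boundary_point t)"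
      using Re Im sin_gt_zero[OF \<theta>] by simp
    also have "\<dots> \<le> Im (cis \<theta> * boundary_point \<theta>)"
      by (rule boundary_point_extremal[OF \<theta> t])
    finally show "Im (cis \<theta> * z) < Im (cis \<theta> * boundary_point \<theta>)" .
  qed
next
  assume H: "\<forall>\<theta>\<in>{0<..<pi}. Im (cis \<theta> * z) < Im (cis \<theta> * boundary_point \<theta>)"
  \<comment> \<open>\<open>\<epsilon>\<close> is so small that \<open>ln (2 * sin \<epsilon>) \<le> ln (2 * \<epsilon>) \<le> Re z\<close>.\<close>
  define \<epsilon> where "\<epsilon> = min 1 (exp (Re z) / 2)"
  have \<epsilon>: "0 < \<epsilon>" "\<epsilon> < pi / 2" "\<epsilon> < pi" "2 * \<epsilon> \<le> exp (Re z)"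
    using pi_gt3 by (auto simp: \<epsilon>_def)
  have s: "0 < sin \<epsilon>" "0 < cos \<epsilon>" "sin \<epsilon> \<le> \<epsilon>"
    using \<epsilon> sin_gt_zero[of \<epsilon>] cos_gt_zero[of \<epsilon>] sin_x_le_x[of \<epsilon>] by auto
  have ln_le: "ln (2 * sin \<epsilon>) \<le> Re z"
    using s \<epsilon>(4) ln_le_cancel_iff[of "2 * sin \<epsilon>" "exp (Re z)"] by simp
  have "Im z < pi / 2"
  proof (rule ccontr)
    assume "\<not> Im z < pi / 2"
    then have "cos \<epsilon> * (pi / 2 - \<epsilon>) \<le> cos \<epsilon> * Im z" using s \<epsilon> by (intro mult_left_mono) auto
    moreover have "sin \<epsilon> * ln (2 * sin \<epsilon>) \<le> sin \<epsilon> * Re z" using s ln_le by (intro mult_left_mono) auto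
    moreover have "Im (cis \<epsilon> * z) < Im (cis \<epsilon> * boundary_point \<epsilon>)" using H \<epsilon> by simp
    ultimately show False by (simp add: boundary_point_def)
  qed
  moreover have "- (pi / 2) < Im z"
  proof (rule ccontr)
    assume "\<not> - (pi / 2) < Im z"
    then have "cos \<epsilon> * (pi / 2 - \<epsilon>) \<le> cos \<epsilon> * - Im z" using s \<epsilon> by (intro mult_left_mono) auto
    moreover have "sin \<epsilon> * ln (2 * sin \<epsilon>) \<le> sin \<epsilon> * Re z" using s ln_le by (intro mult_left_mono) auto
    moreover have "Im (cis (pi - \<epsilon>) * z) < Im (cis (pi - \<epsilon>) * boundary_point (pi - \<epsilon>))"
      by (rule bspec[OF H]) (use \<epsilon> in auto)
    ultimately show False by (simp add: boundary_point_def algebra_simps)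
  qed
  ultimately have Im: "\<bar>Im z\<bar> < pi / 2" by auto
  define \<theta> where "\<theta> = pi / 2 - Im z"
  have \<theta>: "0 < \<theta>" "\<theta> < pi" using Im by (auto simp: \<theta>_def)
  have "Im (cis \<theta> * z) < Im (cis \<theta> * boundary_point \<theta>)" using H \<theta> by simp
  then have "Re z < ln (2 * sin \<theta>)"
    using sin_gt_zero[OF \<theta>] by (simp add: boundary_point_def \<theta>_def)
  then have "exp (Re z) < 2 * sin \<theta>"
    using sin_gt_zero[OF \<theta>] exp_less_cancel_iff[of "Re z" "ln (2 * sin \<theta>)"] by simp
  then show "z \<in> Omega1" using Im by (simp add: Omega1_eq \<theta>_def sin_diff)
qed

lemma convex_Omega1: "convex Omega1"
proof -
  have "Omega1 = (\<Inter>\<theta>\<in>{0<..<pi}. {z. Complex (sin \<theta>) (cos \<theta>) \<bullet> z < Im (cis \<theta> * boundary_point \<theta>)})"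
    by (auto simp: Omega1_iff_half_planes inner_complex_def add.commute)
  also have "convex \<dots>" by (intro convex_INT convex_halfspace_lt)
  finally show ?thesis .
qed

theorem proposition2p5:
  fixes g :: "complex \<Rightarrow> real"
  assumes "g \<in> G1"
    and "\<And>\<theta>. 0 < \<theta> \<Longrightarrow> \<theta> < pi \<Longrightarrow> \<not> ae_eq g (g_disc \<theta>)"
  shows "integrable lebesgue (I_integrand g)
    \<and> I_val g \<in> Omega1
    \<and> open Omega1 \<and> convex Omega1
    \<and> frontier Omega1 = Gamma0
    \<and> Gamma0 = (\<lambda>\<theta>. complex_of_real (ln (2 * sin \<theta>)) + \<i> * complex_of_real (pi / 2 - \<theta>)) ` {0<..<pi}"
proof (intro conjI)
  show "I_val g \<in> Omega1"
    unfolding Omega1_iff_half_planes using Im_cis_I_val_less assms by auto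
  show "Gamma0 = (\<lambda>\<theta>. complex_of_real (ln (2 * sin \<theta>)) + \<i> * complex_of_real (pi / 2 - \<theta>)) ` {0<..<pi}"
    using Gamma0_eq_range_boundary_point unfolding boundary_point_def[abs_def] .
qed (use assms(1) in \<open>simp_all add: integrable_I_integrand open_Omega1 convex_Omega1 frontier_Omega1\<close>)

end
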